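(* Let $N_{\mathrm{card}}$ be a positive integer and let $b>2$ be an integer. Then \[ 2^{N_{\mathrm{card}}}-1 \;>\; b^{\lfloor N_{\mathrm{card}}/(b-1)\rfloor}-1 . \]
   Context: Here $\lfloor x\rfloor$ denotes the floor of the real number $x$. Interpretation: in the base-$b$ guessing scheme, each power of $b$ requires $b-1$ cards (one for each nonzero digit), so with $N_{\mathrm{card}}$ cards the integers that can be guessed range from $1$ up to $b^{\lfloor N_{\mathrm{card}}/(b-1)\rfloor}-1$; for $b=2$ this maximum is $2^{N_{\mathrm{card}}}-1$. *)

theory Defs
  imports Complex_Main
begin

end

theory Submission
  imports Defs
begin

text \<open>Since \<open>b < 2 ^ (b - 1)\<close> for \<open>b > 2\<close>, raising to the power \<open>k = N div (b - 1)\<close> gives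
  \<open>b ^ k < 2 ^ ((b - 1) * k) \<le> 2 ^ N\<close> when \<open>k > 0\<close>; for \<open>k = 0\<close> the claim is \<open>1 < 2 ^ N\<close>.\<close>

text \<open>The induction starts at \<open>3 < 4\<close>; each step adds one on the left but doubles
  the right. At \<open>m = 1\<close> both sides equal 2, which is the excluded base
  \<open>b = 2\<close>.\<close>

lemma Suc_less_two_power:
  fixes m :: nat
  assumes "m \<ge> 2"
  shows "Suc m < 2 ^ m"
  using assms by (induction m rule: dec_induct) auto

lemma Suc_power_div_less_two_power:
  fixes m n :: nat
  assumes "m \<ge> 2" and "n > 0"
  shows "Suc m ^ (n div m) < 2 ^ n"
proof (cases "n div m = 0")
  case True
  then show ?thesis using one_less_power[of "2::nat" n] assms(2) by simp
next
  case False
  \<comment> \<open>The case split supplies the positive exponent that keeps the inequality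
    strict.\<close>
  then have "Suc m ^ (n div m) < (2 ^ m) ^ (n div m)"
    using Suc_less_two_power[OF assms(1)] by (intro power_strict_mono) auto
  also have "\<dots> = 2 ^ (m * (n div m))"
    by (simp add: power_mult)
  also have "\<dots> \<le> 2 ^ n"
    by (intro power_increasing) auto
  finally show ?thesis .
qed

theorem theorem2:
  fixes N_card :: nat and b :: int
  assumes "N_card > 0" and "b > 2"
  shows "(2::int) ^ N_card - 1 > b ^ nat \<lfloor>real N_card / real_of_int (b - 1)\<rfloor> - 1"
proof -
  \<comment> \<open>\<open>m\<close> counts the nonzero digits in base \<open>b\<close>; as a
    natural number it turns the floor of the real quotient into \<open>N_card div m\<close>.\<close>
  define m where "m = nat (b - 1)"
  have m: "m \<ge> 2" and b: "b = int (Suc m)"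
    using assms(2) by (auto simp: m_def)
  have "nat \<lfloor>real N_card / real_of_int (b - 1)\<rfloor> = N_card div m"
    using floor_divide_of_nat_eq[of N_card m, where ?'a = real] by (simp add: b)
  moreover have "int (Suc m ^ (N_card div m)) < int (2 ^ N_card)"
    using Suc_power_div_less_two_power[OF m assms(1)] by (simp only: of_nat_less_iff)
  ultimately show ?thesis
    by (simp add: b)
qed

end
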